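(* Let $m$ be a positive integer and let $$W=(m\mathbb{N}+X_m)\cup Y^{(0)}\cup Y^{(1)},$$ where $X_m\subseteq\{0,1,\dots,m-1\}$, $Y^{(0)}\subseteq\mathbb{Z}^{-}$ and $Y^{(1)}\subseteq\mathbb{Z}$ are finite sets, $(Y^{(0)} \bmod m)\subseteq X_m$, and $(Y^{(1)} \bmod m)\cap X_m=\emptyset$. Suppose that there exists $C\subseteq\{0,1,\dots,m-1\}$ such that the following two conditions hold: (a) $\bigl(C+(X_m\cup Y^{(1)})\bigr) \bmod m=\{0,1,\dots,m-1\}$; (b) for any $c\in C$, there exists $y\in Y^{(1)}$ such that $c+y\not\equiv c'+x \pmod m$ for any $c'\in C\setminus\{c\}$ and $x\in X_m\cup Y^{(1)}$. Then there exists a minimal complement to $W$.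
   Context: $\mathbb{N}$ is the set of nonnegative integers, $\mathbb{Z}$ the set of integers, $\mathbb{Z}^{-}$ the set of negative integers. For $A,B\subseteq\mathbb{Z}$ and $k\in\mathbb{Z}$, $A+B=\{a+b: a\in A, b\in B\}$ and $kA=\{ka:a\in A\}$. A set $A\subseteq\mathbb{Z}$ is a complement to $B\subseteq\mathbb{Z}$ (in $\mathbb{Z}$) if $A+B=\mathbb{Z}$; it is a minimal complement to $B$ if in addition no proper subset of $A$ is a complement to $B$. For a set $S$ of integers, $S \bmod m=\{r\in\{0,1,\dots,m-1\}: r\equiv s \pmod m \text{ for some } s\in S\}$. *)

theory Defs
  imports "HOL-Library.Set_Algebras" "HOL-Number_Theory.Cong"
begin

(* The sum A + B of sets of integers is the elementwise (Minkowski) sum of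
   Set_Algebras, and k *o A is the dilate {k * a | a. a \<in> A}. *)

definition is_complement :: "int set \<Rightarrow> int set \<Rightarrow> bool" where
  "is_complement A B \<longleftrightarrow> A + B = UNIV"

definition is_minimal_complement :: "int set \<Rightarrow> int set \<Rightarrow> bool" where
  "is_minimal_complement A B \<longleftrightarrow>
     is_complement A B \<and> (\<forall>A'. A' \<subset> A \<longrightarrow> \<not> is_complement A' B)"

definition set_mod :: "int set \<Rightarrow> int \<Rightarrow> int set" where
  "set_mod S m = {r \<in> {0..<m}. \<exists>s\<in>S. [r = s] (mod m)}"

end

theory Submission
  imports Defs
begin

text \<open>
  Why the theorem holds. Minimal complements to a \<^emph>\<open>finite\<close> set exist by compactness: whether an
  integer is covered depends on finitely many candidate summands, so the covering condition survives
  intersections of chains and Zorn's lemma applies (\<open>minimal_cover_exists\<close>). The set \<open>W\<close> is infinite,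
  and in general a decreasing chain of complements could lose a point because its summands escape
  to \<open>-\<infinity>\<close>. Condition (b) excludes this for sets \<open>A\<close> made of residues from \<open>C\<close>.

  By (b), every \<open>c \<in> C\<close> owns a residue class \<open>c + y\<close> that is reached from no other element of \<open>C\<close> and
  that is not of the form \<open>c + x\<close> with \<open>x \<in> X\<close>, as \<open>y\<close> lies outside \<open>X\<close> modulo \<open>m\<close>. Covering this
  class is therefore the task of the elements of \<open>A\<close> congruent to \<open>c\<close>, shifted by the finitely many
  elements of \<open>Y1\<close>; as the class extends to \<open>-\<infinity>\<close>, so do those elements of \<open>A\<close>
  (\<open>unbounded_below_if_covers\<close>). Once this is known, all classes in \<open>C + X\<close> are covered for free by
  the progressions in \<open>W\<close>. Hence \<open>A\<close> is a complement to \<open>W\<close> exactly when \<open>A + Y1\<close> covers the classes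
  outside \<open>C + X\<close> (\<open>complement_iff_covers\<close>), which is a covering problem for the finite set \<open>Y1\<close>. It is
  solvable by (a), so it has a minimal solution, and that solution is a minimal complement to \<open>W\<close>.
\<close>

text \<open>
  The reason is compactness: the points that may cover \<open>n\<close> form the finite set \<open>n - F\<close>, so if the
  members of a chain each leave one of them in place, then so does the union of what they remove.
\<close>

lemma minimal_cover_exists:
  fixes A0 D F :: "'a::ab_group_add set"
  assumes fin: "finite F" and cover: "D \<subseteq> A0 + F"
  shows "\<exists>A\<subseteq>A0. D \<subseteq> A + F \<and> (\<forall>A'. A' \<subset> A \<longrightarrow> \<not> D \<subseteq> A' + F)"
proof -
  \<comment> \<open>Zorn's lemma gives maximal sets, so it is applied to the sets that are removed from \<open>A0\<close>.\<close>
  let ?S = "{R. R \<subseteq> A0 \<and> D \<subseteq> (A0 - R) + F}"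
  have "\<exists>M\<in>?S. \<forall>R\<in>?S. M \<subseteq> R \<longrightarrow> R = M"
  proof (rule subset_Zorn_nonempty)
    have "{} \<in> ?S" using cover by simp
    then show "?S \<noteq> {}" by (intro notI) (simp only: empty_iff)
  next
    fix \<C> assume ne: "\<C> \<noteq> {}" and chain: "subset.chain ?S \<C>"
    then have sub: "\<C> \<subseteq> ?S" by (simp add: subset.chain_def)
    have "D \<subseteq> (A0 - \<Union>\<C>) + F"
    proof
      fix n assume n: "n \<in> D"
      show "n \<in> (A0 - \<Union>\<C>) + F"
      proof (rule ccontr)
        assume not: "n \<notin> (A0 - \<Union>\<C>) + F"
        let ?P = "(\<lambda>f. n - f) ` F \<inter> A0"
        have "?P \<subseteq> \<Union>\<C>"
        proof
          fix p assume "p \<in> ?P"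
          then obtain f where f: "f \<in> F" "p = n - f" "p \<in> A0" by blast
          then have "n = p + f" by simp
          then have "p \<notin> A0 - \<Union>\<C>" using not f(1) set_plus_intro by metis
          with f(3) show "p \<in> \<Union>\<C>" by blast
        qed
        moreover have "finite ?P" using fin by simp
        ultimately obtain R where R: "R \<in> \<C>" "?P \<subseteq> R"
          using finite_subset_Union_chain[OF _ _ ne chain] by metis
        with sub n have "n \<in> (A0 - R) + F" by blast
        then obtain a f where "a \<in> A0" "a \<notin> R" "f \<in> F" "n = a + f"
          by (auto elim: set_plus_elim)
        moreover from this have "a = n - f" by simp
        ultimately show False using R(2) by blast
      qed
    qed
    with sub show "\<Union>\<C> \<in> ?S" by blast
  qed
  then obtain M where M_in: "M \<in> ?S" and max: "\<forall>R\<in>?S. M \<subseteq> R \<longrightarrow> R = M" by (rule bexE)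
  then have M: "M \<subseteq> A0" "D \<subseteq> (A0 - M) + F" by simp_all
  have "\<not> D \<subseteq> A' + F" if A': "A' \<subset> A0 - M" for A'
  proof
    assume "D \<subseteq> A' + F"
    moreover have "A0 - (A0 - A') = A'" using A' by blast
    ultimately have "A0 - A' \<in> ?S" by simp
    moreover have "M \<subseteq> A0 - A'" using A' M(1) by blast
    ultimately have "A0 - A' = M" using max by (metis (no_types, lifting))
    with A' show False by blast
  qed
  with M(2) show ?thesis by (intro exI[of _ "A0 - M"]) simp
qed

definition residue_hull :: "int \<Rightarrow> int set \<Rightarrow> int set" where
  "residue_hull m S = {n. \<exists>s\<in>S. [n = s] (mod m)}"

lemma mod_in_set_mod_iff:
  assumes "m > 0"
  shows "n mod m \<in> set_mod S m \<longleftrightarrow> n \<in> residue_hull m S"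
  using assms by (simp add: set_mod_def residue_hull_def cong_def)

text \<open>
  The class of \<open>c + y\<close> avoids \<open>C + X\<close> and is reachable only from summands congruent to \<open>c\<close>. Points
  of this class far below \<open>b\<close> must be covered, and the summands from the finite set \<open>Y\<close> change them
  by a bounded amount only.
\<close>

lemma unbounded_below_if_covers:
  fixes m :: int
  assumes m: "m > 0" and fin: "finite Y"
    and A: "A \<subseteq> residue_hull m C"
    and cover: "- residue_hull m (C + X) \<subseteq> A + Y"
    and y: "y \<notin> residue_hull m X"
    and own: "\<And>c' x. c' \<in> C \<Longrightarrow> c' \<noteq> c \<Longrightarrow> x \<in> X \<union> Y \<Longrightarrow> \<not> [c + y = c' + x] (mod m)"
  shows "\<exists>a\<in>A. [a = c] (mod m) \<and> a \<le> b"
proof -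
  obtain M where M: "\<And>z. z \<in> Y \<Longrightarrow> \<bar>z\<bar> \<le> M" and M0: "M \<ge> 0"
  proof
    show "\<bar>z\<bar> \<le> (\<Sum>z\<in>Y. \<bar>z\<bar>)" if "z \<in> Y" for z
      using member_le_sum[OF that, of abs] fin by simp
    show "(\<Sum>z\<in>Y. \<bar>z\<bar>) \<ge> 0" by (simp add: sum_nonneg)
  qed
  \<comment> \<open>With this \<open>k\<close>, the point \<open>n\<close> lies below \<open>b - M\<close>, so subtracting any element of \<open>Y\<close> stays below \<open>b\<close>.\<close>
  define k where "k = \<bar>c\<bar> + \<bar>y\<bar> + M + \<bar>b\<bar>"
  define n where "n = c + y - m * k"
  have "k \<ge> 0" using M0 by (simp add: k_def)
  then have "k \<le> m * k" using m by (simp add: mult_le_cancel_right1)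
  then have n_le: "n \<le> b - M" by (simp add: n_def k_def)
  have n_cong: "[c + y = n] (mod m)"
    by (simp add: n_def cong_iff_dvd_diff)
  have "n \<notin> residue_hull m (C + X)"
  proof
    assume "n \<in> residue_hull m (C + X)"
    then obtain c' x where cx: "c' \<in> C" "x \<in> X" "[n = c' + x] (mod m)"
      by (auto simp: residue_hull_def elim: set_plus_elim)
    then have *: "[c + y = c' + x] (mod m)" using n_cong cong_trans by blast
    with own cx have "c' = c" by blast
    with * have "[y = x] (mod m)" by (simp add: cong_add_lcancel)
    with cx y show False by (auto simp: residue_hull_def)
  qed
  then have "n \<in> A + Y" using cover by blast
  then obtain a z where az: "a \<in> A" "z \<in> Y" "n = a + z" by (auto elim: set_plus_elim)
  obtain c' where c': "c' \<in> C" "[a = c'] (mod m)"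
    using A az(1) by (auto simp: residue_hull_def)
  then have "[c + y = c' + z] (mod m)"
    using n_cong az(3) by (meson cong_add cong_refl cong_trans)
  with own c'(1) az(2) have "c' = c" by blast
  moreover have "a \<le> b" using n_le az M[OF az(2)] by linarith
  ultimately show ?thesis using az(1) c'(2) by blast
qed

text \<open>
  This removes the infinite part of \<open>W\<close> from the problem. Elements of \<open>W\<close> in the classes of \<open>X\<close> never
  help outside \<open>C + X\<close>, and inside \<open>C + X\<close> the upward progressions suffice, since the elements of \<open>A\<close>
  in each class of \<open>C\<close> reach arbitrarily far down.
\<close>

lemma complement_iff_covers:
  fixes m :: int
  assumes m: "m > 0" and fin: "finite Y"
    and progressions: "m *o \<nat> + X \<subseteq> W" and Y: "Y \<subseteq> W" and W: "W \<subseteq> residue_hull m X \<union> Y"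
    and disj: "Y \<inter> residue_hull m X = {}"
    and own: "\<And>c. c \<in> C \<Longrightarrow>
      \<exists>y\<in>Y. \<forall>c'\<in>C - {c}. \<forall>x\<in>X \<union> Y. \<not> [c + y = c' + x] (mod m)"
    and A: "A \<subseteq> residue_hull m C"
  shows "is_complement A W \<longleftrightarrow> - residue_hull m (C + X) \<subseteq> A + Y"
proof
  assume compl: "is_complement A W"
  show "- residue_hull m (C + X) \<subseteq> A + Y"
  proof
    fix n assume n: "n \<in> - residue_hull m (C + X)"
    have "n \<in> A + W" using compl by (simp add: is_complement_def)
    then obtain a w where aw: "a \<in> A" "w \<in> W" "n = a + w" by (auto elim: set_plus_elim)
    have "w \<in> Y"
    proof (rule ccontr)
      assume "w \<notin> Y"
      with W aw obtain x where x: "x \<in> X" "[w = x] (mod m)" by (auto simp: residue_hull_def)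
      from A aw obtain c where c: "c \<in> C" "[a = c] (mod m)" by (auto simp: residue_hull_def)
      have "[n = c + x] (mod m)" using x c aw by (simp add: cong_add)
      with x c n show False by (auto simp: residue_hull_def)
    qed
    with aw show "n \<in> A + Y" by auto
  qed
next
  assume cover: "- residue_hull m (C + X) \<subseteq> A + Y"
  have "n \<in> A + W" for n
  proof (cases "n \<in> residue_hull m (C + X)")
    case True
    then obtain c x where cx: "c \<in> C" "x \<in> X" "[n = c + x] (mod m)"
      by (auto simp: residue_hull_def elim: set_plus_elim)
    obtain y where y: "y \<in> Y" "\<forall>c'\<in>C - {c}. \<forall>x\<in>X \<union> Y. \<not> [c + y = c' + x] (mod m)"
      using own[OF cx(1)] by blast
    have "y \<notin> residue_hull m X" using disj y(1) by blast
    then obtain a where a: "a \<in> A" "[a = c] (mod m)" "a \<le> n - x"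
      using unbounded_below_if_covers[OF m fin A cover, of y c "n - x"] y(2) by blast
    have "[a + x = c + x] (mod m)" using a(2) by (simp add: cong_add)
    then have "[n = a + x] (mod m)" using cx(3) cong_sym cong_trans by blast
    then obtain k where k: "n - (a + x) = m * k" by (auto simp: cong_iff_dvd_diff elim: dvdE)
    have "m * k \<ge> 0" using a(3) k by linarith
    then have "k \<ge> 0" using m by (simp add: zero_le_mult_iff)
    then have "k \<in> \<nat>" by (metis int_nat_eq of_nat_in_Nats)
    then have "m * k \<in> m *o \<nat>" unfolding elt_set_times_def by blast
    then have "m * k + x \<in> W" using progressions cx(2) by blast
    moreover have "n = a + (m * k + x)" using k by linarith
    ultimately show ?thesis using a(1) by blast
  next
    case False
    then have "n \<in> A + Y" using cover by blast
    then show ?thesis using Y set_plus_mono2 by blast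
  qed
  then show "is_complement A W" by (auto simp: is_complement_def)
qed

theorem theorem2:
  fixes m :: int and W X Y0 Y1 :: "int set"
  assumes "m > 0"
    and "W = (m *o \<nat> + X) \<union> Y0 \<union> Y1"
    and "X \<subseteq> {0..<m}" and "finite X"
    and "Y0 \<subseteq> {..<0}" and "finite Y0"
    and "finite Y1"
    and "set_mod Y0 m \<subseteq> X"
    and "set_mod Y1 m \<inter> X = {}"
    and "\<exists>C. C \<subseteq> {0..<m} \<and>
           set_mod (C + (X \<union> Y1)) m = {0..<m} \<and>
           (\<forall>c\<in>C. \<exists>y\<in>Y1. \<forall>c'\<in>C - {c}. \<forall>x\<in>X \<union> Y1. \<not> [c + y = c' + x] (mod m))"
  shows "\<exists>A. is_minimal_complement A W"
proof -
  note m = assms(1)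
  obtain C where all: "set_mod (C + (X \<union> Y1)) m = {0..<m}"
    and own: "\<forall>c\<in>C. \<exists>y\<in>Y1. \<forall>c'\<in>C - {c}. \<forall>x\<in>X \<union> Y1. \<not> [c + y = c' + x] (mod m)"
    using assms(10) by blast
  have Y0: "Y0 \<subseteq> residue_hull m X"
  proof
    fix y assume "y \<in> Y0"
    then have "y mod m \<in> set_mod Y0 m"
      using m by (auto simp: set_mod_def cong_def)
    then have "y mod m \<in> X" using assms(8) by blast
    then have "\<exists>x\<in>X. [y = x] (mod m)"
      by (intro bexI[of _ "y mod m"]) (simp_all add: cong_def)
    then show "y \<in> residue_hull m X" by (simp add: residue_hull_def)
  qed
  have "m *o \<nat> + X \<subseteq> residue_hull m X"
    by (auto simp: residue_hull_def elt_set_times_def cong_def elim!: set_plus_elim)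
  then have W: "W \<subseteq> residue_hull m X \<union> Y1" using Y0 assms(2) by blast
  have disj: "Y1 \<inter> residue_hull m X = {}"
  proof (rule ccontr)
    assume "Y1 \<inter> residue_hull m X \<noteq> {}"
    then obtain y x where yx: "y \<in> Y1" "x \<in> X" "[y = x] (mod m)"
      by (auto simp: residue_hull_def)
    then have "\<exists>s\<in>Y1. [x = s] (mod m)" using cong_sym by blast
    then have "x \<in> set_mod Y1 m" using assms(3) yx(2) by (auto simp: set_mod_def)
    with yx assms(9) show False by blast
  qed
  have iff: "is_complement A W \<longleftrightarrow> - residue_hull m (C + X) \<subseteq> A + Y1"
    if "A \<subseteq> residue_hull m C" for A
    using complement_iff_covers[OF m assms(7) _ _ W disj _ that] own assms(2) by blast
  have "- residue_hull m (C + X) \<subseteq> residue_hull m C + Y1"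
  proof
    fix n assume n: "n \<in> - residue_hull m (C + X)"
    have "n mod m \<in> set_mod (C + (X \<union> Y1)) m" using all m by simp
    then have "n \<in> residue_hull m (C + (X \<union> Y1))" using mod_in_set_mod_iff[OF m] by blast
    then obtain c y where cy: "c \<in> C" "y \<in> X \<union> Y1" "[n = c + y] (mod m)"
      by (auto simp: residue_hull_def elim!: set_plus_elim)
    with n have "y \<in> Y1" by (auto simp: residue_hull_def)
    moreover have "[n - y = c] (mod m)" using cy(3) by (simp add: cong_iff_dvd_diff algebra_simps)
    ultimately have "(n - y) + y \<in> residue_hull m C + Y1"
      using cy(1) by (intro set_plus_intro) (auto simp: residue_hull_def)
    then show "n \<in> residue_hull m C + Y1" by simp
  qed
  then obtain A where A: "A \<subseteq> residue_hull m C" "- residue_hull m (C + X) \<subseteq> A + Y1"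
    and min: "\<forall>A'. A' \<subset> A \<longrightarrow> \<not> - residue_hull m (C + X) \<subseteq> A' + Y1"
    using minimal_cover_exists[OF assms(7)] by meson
  have "\<not> is_complement A' W" if "A' \<subset> A" for A'
    using iff[of A'] min that A(1) by blast
  with iff[OF A(1)] A(2) show ?thesis unfolding is_minimal_complement_def by blast
qed

end
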